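(* Let $(W,S)$ be a Coxeter system and $s\in S$. The following statements are equivalent: (i) $W$ satisfies the nested condition relative to $s$. (ii) For every $u\in S\setminus\{s\}$, $\mathrm{m}_{su}\in\{2,\infty\}$.
   Context: Coxeter systems. $S$ is a finite set, $(\mathrm{m}_{st})_{s,t\in S}$ is a symmetric matrix with $\mathrm{m}_{ss}=1$ and $\mathrm{m}_{st}\in\{2,3,\dots,\infty\}$ for $s\neq t$, and $W=\langle S: (st)^{\mathrm{m}_{st}}=1\rangle$ (no relation when $\mathrm{m}_{st}=\infty$). $l$ is the word length on $W$. Coxeter complex. $\Sigma(W,S)$ is obtained by gluing copies $wK$ ($w\in W$; the chambers) of a $(|S|-1)$-simplex $K$ with codimension-one faces $K_s$, where $wK$ and $wsK$ are glued along the face of type $s$ (equivalently, it is the realization of the poset $\{wW_T: w\in W,T\subsetneq S\}$, $W_T$ being the subgroup generated by $T$); $W$ acts by $g\cdot wK=gwK$. The wall $H_s$ is the set of simplices fixed by $s$; it partitions the chambers into two roots interchanged by $s$: $H_s^+$, containing $K$, and $H_s^-$. Explicitly $gK\in H_s^+$ iff $l(g)<l(sg)$, and $gK\in H_s^-$ iff $l(g)>l(sg)$. Roots may be identified with their sets of chambers. Nested condition. $W$ satisfies the nested condition relative to $s$ if for every $g\in W$ one of the following holds: $g\cdot H_s^+=H_s^+$, $g\cdot H_s^+=H_s^-$, $g\cdot H_s^+\subsetneq H_s^+$, $g\cdot H_s^+\subsetneq H_s^-$, $g\cdot H_s^-\subsetneq H_s^+$, or $g\cdot H_s^-\subsetneq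 H_s^-$. *)

theory Defs
  imports "HOL-Algebra.Coset" "HOL-Algebra.Generated_Groups" "HOL-Library.Extended_Nat"
begin

text \<open>
  Words over a set of generators: the letter \<open>(x, True)\<close> stands for \<open>x\<close> and \<open>(x, False)\<close> for
  its inverse.
\<close>

definition eval_word :: "('g, 'b) monoid_scheme \<Rightarrow> ('g \<times> bool) list \<Rightarrow> 'g" where
  "eval_word G w =
     foldr (\<lambda>(x, e) y. (if e then x else inv\<^bsub>G\<^esub> x) \<otimes>\<^bsub>G\<^esub> y) w \<one>\<^bsub>G\<^esub>"

text \<open>
  Elementary deletion of a factor \<open>x x\<inverse>\<close>, \<open>x\<inverse> x\<close> or of a relator.  Words modulo the generated
  equivalence relation form the group \<open>\<langle>X : r = 1 for r \<in> R\<rangle>\<close>.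
\<close>

inductive word_step :: "'g set \<Rightarrow> ('g \<times> bool) list set \<Rightarrow> ('g \<times> bool) list \<Rightarrow> ('g \<times> bool) list \<Rightarrow> bool"
  for X R where
  cancel: "x \<in> X \<Longrightarrow> word_step X R (u @ [(x, e), (x, \<not> e)] @ v) (u @ v)"
| relator: "r \<in> R \<Longrightarrow> word_step X R (u @ r @ v) (u @ v)"

definition presented_by :: "('g, 'b) monoid_scheme \<Rightarrow> 'g set \<Rightarrow> ('g \<times> bool) list set \<Rightarrow> bool" where
  "presented_by G X R \<longleftrightarrow>
     X \<subseteq> carrier G \<and> R \<subseteq> lists (X \<times> UNIV) \<and> generate G X = carrier G \<and>
     (\<forall>w \<in> lists (X \<times> UNIV). eval_word G w = \<one>\<^bsub>G\<^esub> \<longleftrightarrow> equivclp (word_step X R) w [])"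

definition coxeter_relators :: "'g set \<Rightarrow> ('g \<Rightarrow> 'g \<Rightarrow> enat) \<Rightarrow> ('g \<times> bool) list set" where
  "coxeter_relators S m =
     {concat (replicate k [(s, True), (t, True)]) | s t k. s \<in> S \<and> t \<in> S \<and> m s t = enat k}"

locale coxeter_system = group W for W :: "('g, 'b) monoid_scheme" (structure) +
  fixes S :: "'g set" and m :: "'g \<Rightarrow> 'g \<Rightarrow> enat"
  assumes finite_S: "finite S"
    and m_diag: "s \<in> S \<Longrightarrow> m s s = 1"
    and m_sym: "s \<in> S \<Longrightarrow> t \<in> S \<Longrightarrow> m s t = m t s"
    and m_ge_2: "s \<in> S \<Longrightarrow> t \<in> S \<Longrightarrow> s \<noteq> t \<Longrightarrow> 2 \<le> m s t"
    and presented: "presented_by W S (coxeter_relators S m)"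

definition word_length :: "('g, 'b) monoid_scheme \<Rightarrow> 'g set \<Rightarrow> 'g \<Rightarrow> nat" where
  "word_length G X g =
     (LEAST n. \<exists>w \<in> lists (X \<times> UNIV). length w = n \<and> eval_word G w = g)"

text \<open>
  The simplices of the Coxeter complex are the cosets \<open>w W\<^sub>T\<close> with \<open>T\<close> a proper subset of \<open>S\<close>, ordered
  by reverse inclusion.  The chamber \<open>wK\<close> is the coset of the trivial subgroup \<open>W\<^sub>T\<close>, \<open>T = {}\<close>, and the group acts on simplices by
  left translation.
\<close>

definition chamber :: "('g, 'b) monoid_scheme \<Rightarrow> 'g \<Rightarrow> 'g set" where
  "chamber W w = w <#\<^bsub>W\<^esub> generate W {}"

definition act :: "('g, 'b) monoid_scheme \<Rightarrow> 'g \<Rightarrow> 'g set set \<Rightarrow> 'g set set" where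
  "act W g A = (\<lambda>C. g <#\<^bsub>W\<^esub> C) ` A"

text \<open>Roots are identified with their sets of chambers.\<close>

definition pos_root :: "('g, 'b) monoid_scheme \<Rightarrow> 'g set \<Rightarrow> 'g \<Rightarrow> 'g set set" where
  "pos_root W S s =
     {chamber W g | g. g \<in> carrier W \<and> word_length W S g < word_length W S (s \<otimes>\<^bsub>W\<^esub> g)}"

definition neg_root :: "('g, 'b) monoid_scheme \<Rightarrow> 'g set \<Rightarrow> 'g \<Rightarrow> 'g set set" where
  "neg_root W S s =
     {chamber W g | g. g \<in> carrier W \<and> word_length W S g > word_length W S (s \<otimes>\<^bsub>W\<^esub> g)}"

definition nested_condition :: "('g, 'b) monoid_scheme \<Rightarrow> 'g set \<Rightarrow> 'g \<Rightarrow> bool" where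
  "nested_condition W S s \<longleftrightarrow>
     (\<forall>g \<in> carrier W.
        act W g (pos_root W S s) = pos_root W S s \<or>
        act W g (pos_root W S s) = neg_root W S s \<or>
        act W g (pos_root W S s) \<subset> pos_root W S s \<or>
        act W g (pos_root W S s) \<subset> neg_root W S s \<or>
        act W g (neg_root W S s) \<subset> pos_root W S s \<or>
        act W g (neg_root W S s) \<subset> neg_root W S s)"

end

theory Submission
  imports Defs Complex_Main
begin

text \<open>
  The parity of the number of occurrences of a reflection \<open>r\<close> in the reflection sequence of a word
  depends only on the element \<open>x\<close> of \<open>W\<close>; when it is odd, \<open>x\<close> inverts \<open>r\<close> and \<open>rx\<close> is shorter than
  \<open>x\<close>.  So \<open>H\<^sub>s\<^sup>-\<close> consists of the elements inverting \<open>s\<close>, and \<open>g\<close> violates the nested condition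
  iff each of \<open>gH\<^sub>s\<^sup>+\<close>, \<open>gH\<^sub>s\<^sup>-\<close> meets each of \<open>H\<^sub>s\<^sup>+\<close>, \<open>H\<^sub>s\<^sup>-\<close>.

  If \<open>3 \<le> m\<^sub>s\<^sub>u < \<infinity>\<close>, then \<open>g = u\<close> violates it: \<open>s\<close> and \<open>u\<close> do not commute (seen in the
  geometric representation), and the dihedral group \<open>\<langle>s, u\<rangle>\<close> supplies chambers of all four kinds.

  Conversely, let all \<open>m\<^sub>s\<^sub>u\<close> be \<open>2\<close> or \<open>\<infinity>\<close>.  Then \<open>s\<close> is conjugate to no other generator, and its
  centralizer is generated by \<open>s\<close> and the generators commuting with it.  If all four intersections
  are nonempty, then galleries inside \<open>gH\<^sub>s\<^sup>+\<close> and inside \<open>gH\<^sub>s\<^sup>-\<close> cross the wall \<open>H\<^sub>s\<close>, both at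
  chambers of the centralizer of \<open>s\<close>.  These two chambers are joined by a gallery in the centralizer,
  and this gallery does not cross the wall \<open>gH\<^sub>s\<close>, a contradiction.
\<close>

subsection \<open>Linear recurrences of order two\<close>

text \<open>Both sides satisfy the same recurrence in \<open>k\<close>, by the addition formula for
  \<open>sin (y + \<theta>)\<close>.\<close>

lemma linear_recurrence_sin:
  fixes z :: "nat \<Rightarrow> real"
  assumes "\<And>k. z (Suc (Suc k)) = 2 * cos \<theta> * z (Suc k) - z k"
  shows "z k * sin \<theta> = z 1 * sin (k * \<theta>) - z 0 * sin (k * \<theta> - \<theta>)"
proof (induction k rule: induct_nat_012)
  case 0
  then show ?case by simp
next
  case 1
  then show ?case by simp
next
  case (ge2 n)
  have tr: "sin (y + \<theta>) = 2 * cos \<theta> * sin y - sin (y - \<theta>)" for y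
    by (simp add: sin_add sin_diff)
  have "z (Suc (Suc n)) * sin \<theta> = 2 * cos \<theta> * (z (Suc n) * sin \<theta>) - z n * sin \<theta>"
    unfolding assms by (simp add: algebra_simps)
  also have "\<dots> = z 1 * (2 * cos \<theta> * sin (Suc n * \<theta>) - sin (n * \<theta>))
      - z 0 * (2 * cos \<theta> * sin (Suc n * \<theta> - \<theta>) - sin (n * \<theta> - \<theta>))"
    unfolding ge2 by (simp add: algebra_simps)
  also have "2 * cos \<theta> * sin (Suc n * \<theta>) - sin (n * \<theta>) = sin (Suc (Suc n) * \<theta>)"
    using tr[of "Suc n * \<theta>"] by (simp add: algebra_simps)
  also have "2 * cos \<theta> * sin (Suc n * \<theta> - \<theta>) - sin (n * \<theta> - \<theta>) = sin (Suc (Suc n) * \<theta> - \<theta>)"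
    using tr[of "n * \<theta>"] by (simp add: algebra_simps)
  finally show ?case .
qed

lemma linear_recurrence_periodic:
  fixes z :: "nat \<Rightarrow> real"
  assumes rec: "\<And>k. z (Suc (Suc k)) = 2 * cos (pi / n) * z (Suc k) - z k" and n: "2 \<le> n"
  shows "z (k + 2 * n) = z k"
    and "(\<Sum>i<n. z (2 * i)) = 0" and "(\<Sum>i<n. z (2 * i + 1)) = 0"
proof -
  define \<theta> where "\<theta> = pi / n"
  have "0 < \<theta>" "\<theta> < pi"
    using n by (auto simp: \<theta>_def field_simps)
  then have sin: "sin \<theta> > 0"
    by (rule sin_gt_zero)
  have closed: "z k * sin \<theta> = z 1 * sin (k * \<theta>) - z 0 * sin (k * \<theta> - \<theta>)" for k
    by (rule linear_recurrence_sin) (use rec in \<open>simp add: \<theta>_def\<close>)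
  have per: "z (k + 2 * n) = z k" for k
  proof -
    have k: "(k + 2 * n) * \<theta> = k * \<theta> + 2 * pi"
      using n by (simp add: \<theta>_def field_simps)
    have "sin (k * \<theta> + 2 * pi - \<theta>) = sin (k * \<theta> - \<theta>)"
      using sin_periodic[of "k * \<theta> - \<theta>"] by (simp add: algebra_simps)
    then have "z (k + 2 * n) * sin \<theta> = z k * sin \<theta>"
      using closed[of "k + 2 * n"] closed[of k] k by simp
    with sin show ?thesis by simp
  qed
  then show "z (k + 2 * n) = z k" .
  define E where "E = (\<Sum>i<n. z (2 * i))"
  define O' where "O' = (\<Sum>i<n. z (2 * i + 1))"
  have shift: "(\<Sum>i<n. g (Suc i)) = (\<Sum>i<n. g i)" if "g n = g 0" for g :: "nat \<Rightarrow> real"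
    using sum.lessThan_Suc_shift[of g n] that by simp
  have "(\<Sum>i<n. z (2 * Suc i)) = E"
    unfolding E_def by (rule shift) (use per[of 0] in simp)
  \<comment> \<open>Summing the recurrence over one period gives
    \<open>E = cos \<theta> * O'\<close>; with the parities exchanged it gives
    \<open>O' = cos \<theta> * E\<close>, so \<open>(sin \<theta>)\<^sup>2 * E = 0\<close>.\<close>
  moreover have "(\<Sum>i<n. z (2 * Suc i)) + E = 2 * cos \<theta> * O'"
    unfolding E_def O'_def sum_distrib_left sum.distrib[symmetric]
    by (rule sum.cong) (use rec in \<open>auto simp: \<theta>_def\<close>)
  ultimately have 1: "E = cos \<theta> * O'" by simp
  have "(\<Sum>i<n. z (2 * Suc i + 1)) = O'"
    unfolding O'_def by (rule shift) (use per[of 1] in simp)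
  moreover have "(\<Sum>i<n. z (2 * Suc i + 1)) + O' = 2 * cos \<theta> * (\<Sum>i<n. z (2 * Suc i))"
    unfolding O'_def sum_distrib_left sum.distrib[symmetric]
    by (rule sum.cong) (use rec in \<open>auto simp: \<theta>_def\<close>)
  ultimately have 2: "O' = cos \<theta> * E"
    using \<open>(\<Sum>i<n. z (2 * Suc i)) = E\<close> by simp
  have "E = (cos \<theta>)\<^sup>2 * E"
    using 1 2 by (simp add: power2_eq_square)
  then have "(sin \<theta>)\<^sup>2 * E = 0"
    by (simp add: sin_squared_eq algebra_simps)
  then show "(\<Sum>i<n. z (2 * i)) = 0"
    using sin by (simp add: E_def)
  then show "(\<Sum>i<n. z (2 * i + 1)) = 0"
    using 2 by (simp add: E_def O'_def)
qed

subsection \<open>Words, length and inversions\<close>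

text \<open>
  The number of \<open>i\<close> with \<open>r = x\<^sub>1 \<cdots> x\<^sub>i \<cdots> x\<^sub>1\<close>; exponents of letters are ignored because the
  generators are involutions.
\<close>

primrec refl_count :: "('g, 'b) monoid_scheme \<Rightarrow> ('g \<times> bool) list \<Rightarrow> 'g \<Rightarrow> nat" where
  "refl_count G [] r = 0"
| "refl_count G (a # w) r =
     of_bool (r = fst a) + refl_count G w (fst a \<otimes>\<^bsub>G\<^esub> r \<otimes>\<^bsub>G\<^esub> fst a)"

context coxeter_system
begin

section \<open>Words in the generators and their values\<close>

definition words :: "('g \<times> bool) list set" where "words = lists (S \<times> UNIV)"

lemma Nil_words [simp]: "[] \<in> words"
  by (simp add: words_def)

lemma Cons_words [simp]: "a # w \<in> words \<longleftrightarrow> fst a \<in> S \<and> w \<in> words"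
  by (cases a) (auto simp: words_def)

lemma append_words [simp]: "u @ v \<in> words \<longleftrightarrow> u \<in> words \<and> v \<in> words"
  by (induction u) auto

lemma rev_words [simp]: "rev w \<in> words \<longleftrightarrow> w \<in> words"
  by (induction w) auto

lemma alternating_words [simp]:
  "s \<in> S \<Longrightarrow> t \<in> S \<Longrightarrow> concat (replicate k [(s, True), (t, True)]) \<in> words"
  by (induction k) auto

abbreviation ev :: "('g \<times> bool) list \<Rightarrow> 'g" where "ev \<equiv> eval_word W"

abbreviation len :: "'g \<Rightarrow> nat" where "len \<equiv> word_length W S"

abbreviation relators :: "('g \<times> bool) list set" where "relators \<equiv> coxeter_relators S m"

lemma S_carrier: "s \<in> S \<Longrightarrow> s \<in> carrier W"
  using presented by (auto simp: presented_by_def)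

lemma ev_Nil [simp]: "ev [] = \<one>"
  by (simp add: eval_word_def)

lemma ev_one_iff: "w \<in> words \<Longrightarrow> ev w = \<one> \<longleftrightarrow> equivclp (word_step S relators) w []"
  using presented by (auto simp: presented_by_def words_def)

lemma relators_words: "r \<in> relators \<Longrightarrow> r \<in> words"
  using presented by (auto simp: presented_by_def words_def)

lemma ev_relator: "r \<in> relators \<Longrightarrow> ev r = \<one>"
proof -
  assume r: "r \<in> relators"
  then have "word_step S relators ([] @ r @ []) ([] @ [])"
    by (rule word_step.relator)
  then have "equivclp (word_step S relators) r []"
    by (simp add: r_into_equivclp)
  with r show ?thesis
    by (simp add: ev_one_iff relators_words)
qed

lemma S_square: "s \<in> S \<Longrightarrow> s \<otimes> s = \<one>"
proof -
  assume s: "s \<in> S"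
  have "concat (replicate 1 [(s, True), (s, True)]) \<in> relators"
    unfolding coxeter_relators_def using s m_diag[OF s] by (force simp: one_enat_def)
  then have "ev (concat (replicate 1 [(s, True), (s, True)])) = \<one>"
    by (rule ev_relator)
  with s show ?thesis
    by (simp add: eval_word_def S_carrier)
qed

lemma S_inv: "s \<in> S \<Longrightarrow> inv s = s"
  using S_square S_carrier inv_equality by blast

lemma S_cancel: "s \<in> S \<Longrightarrow> x \<in> carrier W \<Longrightarrow> s \<otimes> (s \<otimes> x) = x"
  using S_square S_carrier by (metis l_one m_assoc)

lemma S_conj_eq:
  "s \<in> S \<Longrightarrow> x \<in> carrier W \<Longrightarrow> y \<in> carrier W \<Longrightarrow> s \<otimes> x \<otimes> s = y \<longleftrightarrow> x = s \<otimes> y \<otimes> s"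
  by (auto simp: S_carrier S_cancel S_square m_assoc)

lemma ev_Cons [simp]: "fst a \<in> S \<Longrightarrow> ev (a # w) = fst a \<otimes> ev w"
  by (cases a) (auto simp: eval_word_def S_inv)

lemma ev_carrier [simp]: "w \<in> words \<Longrightarrow> ev w \<in> carrier W"
  by (induction w) (auto simp: S_carrier)

lemma ev_append [simp]: "u \<in> words \<Longrightarrow> v \<in> words \<Longrightarrow> ev (u @ v) = ev u \<otimes> ev v"
  by (induction u) (auto simp: S_carrier m_assoc)

lemma ev_rev [simp]: "w \<in> words \<Longrightarrow> ev (rev w) = inv (ev w)"
  by (induction w) (auto simp: S_carrier S_inv inv_mult_group)

lemma ex_word: "x \<in> carrier W \<Longrightarrow> \<exists>w\<in>words. ev w = x"
proof -
  assume "x \<in> carrier W"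
  then have "x \<in> generate W S"
    using presented by (simp add: presented_by_def)
  then show ?thesis
  proof induction
    case one
    show ?case by (intro bexI[of _ "[]"]) auto
  next
    case (incl h)
    then show ?case by (intro bexI[of _ "[(h, True)]"]) (auto simp: S_carrier)
  next
    case (inv h)
    then show ?case by (intro bexI[of _ "[(h, True)]"]) (auto simp: S_carrier S_inv)
  next
    case (eng h1 h2)
    then obtain u v where "u \<in> words" "ev u = h1" "v \<in> words" "ev v = h2" by blast
    then show ?case by (intro bexI[of _ "u @ v"]) auto
  qed
qed

lemma word_step_words:
  "word_step S relators v w \<Longrightarrow> v \<in> words \<longleftrightarrow> w \<in> words"
  by (induction rule: word_step.induct) (use relators_words in auto)

text \<open>An invariant of elementary deletions cannot tell a trivial word from the empty one. This
  serves the reflection parities, the geometric representation and the counting of letters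
  \<open>s\<close>.\<close>

lemma word_invariant:
  assumes "w \<in> words" "ev w = \<one>"
    and inv: "\<And>v v'. v \<in> words \<Longrightarrow> v' \<in> words \<Longrightarrow> word_step S relators v v' \<Longrightarrow> F v = F v'"
  shows "F w = F []"
proof -
  have "equivclp (word_step S relators) w []"
    using assms by (simp add: ev_one_iff)
  then have "[] \<in> words \<and> F w = F []"
  proof (induction rule: equivclp_induct)
    case base
    with assms show ?case by simp
  next
    case (step y z)
    with word_step_words[of y z] word_step_words[of z y] inv[of y z] inv[of z y] show ?case by auto
  qed
  then show ?thesis by simp
qed

section \<open>Length and descents\<close>

lemma len_le: "w \<in> words \<Longrightarrow> len (ev w) \<le> length w"
  unfolding word_length_def words_def by (rule Least_le) auto

lemma ex_min_word:
  assumes "x \<in> carrier W" obtains w where "w \<in> words" "ev w = x" "length w = len x"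
proof -
  have "\<exists>n. \<exists>w\<in>words. length w = n \<and> ev w = x"
    using ex_word[OF assms] by blast
  then have "\<exists>w\<in>words. length w = len x \<and> ev w = x"
    unfolding word_length_def words_def by (rule LeastI_ex)
  with that show ?thesis by blast
qed

lemma len_mult_right: "x \<in> carrier W \<Longrightarrow> a \<in> S \<Longrightarrow> len (x \<otimes> a) \<le> Suc (len x)"
proof -
  assume x: "x \<in> carrier W" and a: "a \<in> S"
  obtain w where "w \<in> words" "ev w = x" "length w = len x"
    using ex_min_word[OF x] .
  with a len_le[of "w @ [(a, True)]"] show ?thesis by (simp add: S_carrier)
qed

lemma ex_right_descent:
  assumes "x \<in> carrier W" "x \<noteq> \<one>" obtains a where "a \<in> S" "len (x \<otimes> a) < len x"
proof -
  obtain w where w: "w \<in> words" "ev w = x" "length w = len x"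
    using ex_min_word[OF assms(1)] .
  with assms have "w \<noteq> []" by auto
  then obtain v a where v: "w = v @ [a]" by (metis append_butlast_last_id)
  with w have a: "v \<in> words" "fst a \<in> S" by auto
  have "x \<otimes> fst a = ev v \<otimes> (fst a \<otimes> fst a)"
    using a w v by (auto simp: S_carrier m_assoc)
  also have "\<dots> = ev v" using a by (auto simp: S_square)
  finally have "len (x \<otimes> fst a) \<le> length v" using len_le a by simp
  with that[of "fst a"] a w v show ?thesis by auto
qed

lemma ex_left_descent:
  assumes "x \<in> carrier W" "x \<noteq> \<one>" obtains a where "a \<in> S" "len (a \<otimes> x) < len x"
proof -
  obtain w where w: "w \<in> words" "ev w = x" "length w = len x"
    using ex_min_word[OF assms(1)] .
  with assms have "w \<noteq> []" by auto
  then obtain v a where v: "w = a # v" by (cases w) auto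
  with w have a: "v \<in> words" "fst a \<in> S" by auto
  have "fst a \<otimes> x = ev v"
    using a w v by (auto simp: S_cancel)
  then have "len (fst a \<otimes> x) \<le> length v" using len_le a by simp
  with that[of "fst a"] a w v show ?thesis by auto
qed

section \<open>Parity of the reflection count, and inversions\<close>

lemma refl_count_append:
  assumes "u \<in> words" "r \<in> carrier W"
  shows "refl_count W (u @ v) r = refl_count W u r + refl_count W v (inv (ev u) \<otimes> r \<otimes> ev u)"
  using assms
  by (induction u arbitrary: r) (auto simp: S_carrier S_inv inv_mult_group m_assoc)

lemma ev_alternating:
  "s \<in> S \<Longrightarrow> t \<in> S \<Longrightarrow> ev (concat (replicate k [(s, True), (t, True)])) = (s \<otimes> t) [^] k"
proof (induction k)
  case (Suc k)
  then show ?case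
    using nat_pow_Suc2[of "s \<otimes> t" k] by (simp add: S_carrier m_assoc)
qed simp

text \<open>Stripping the first two letters conjugates by \<open>s \<otimes> t\<close>, which shifts
  the exponent \<open>j\<close> by two.\<close>

lemma refl_count_alternating:
  assumes "s \<in> S" "t \<in> S" "r \<in> carrier W"
  shows "refl_count W (concat (replicate k [(s, True), (t, True)])) r
    = (\<Sum>j<2 * k. of_bool (r = (s \<otimes> t) [^] j \<otimes> s))"
  using \<open>r \<in> carrier W\<close>
proof (induction k arbitrary: r)
  case (Suc k)
  have c: "s \<in> carrier W" "t \<in> carrier W" using assms S_carrier by auto
  have 1: "s \<otimes> r \<otimes> s = t \<longleftrightarrow> r = s \<otimes> t \<otimes> s"
    using c Suc.prems assms by (simp add: S_conj_eq)
  have 2: "t \<otimes> (s \<otimes> r \<otimes> s) \<otimes> t = (s \<otimes> t) [^] j \<otimes> s \<longleftrightarrow> r = (s \<otimes> t) [^] Suc (Suc j) \<otimes> s" for j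
  proof -
    have "t \<otimes> (s \<otimes> r \<otimes> s) \<otimes> t = y \<longleftrightarrow> r = (s \<otimes> t) \<otimes> y \<otimes> inv (s \<otimes> t)"
      if "y \<in> carrier W" for y
      using c Suc.prems that assms
      by (auto simp: inv_mult_group S_inv S_square S_cancel m_assoc)
    moreover have "(s \<otimes> t) \<otimes> ((s \<otimes> t) [^] j \<otimes> s) \<otimes> inv (s \<otimes> t) = (s \<otimes> t) [^] Suc (Suc j) \<otimes> s"
    proof -
      have "(s \<otimes> t) \<otimes> ((s \<otimes> t) [^] j \<otimes> s) \<otimes> inv (s \<otimes> t) = ((s \<otimes> t) \<otimes> (s \<otimes> t) [^] j) \<otimes> (s \<otimes> t) \<otimes> s"
        using c assms by (simp add: inv_mult_group S_inv m_assoc)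
      then show ?thesis
        using c by (simp add: nat_pow_Suc2[symmetric])
    qed
    ultimately show ?thesis using c by simp
  qed
  have "refl_count W (concat (replicate (Suc k) [(s, True), (t, True)])) r =
      of_bool (r = s) + of_bool (r = s \<otimes> t \<otimes> s) +
      (\<Sum>j<2 * k. of_bool (r = (s \<otimes> t) [^] Suc (Suc j) \<otimes> s))"
    using Suc c by (simp add: 1 2 del: nat_pow_Suc)
  also have "\<dots> = (\<Sum>j<Suc (Suc (2 * k)). of_bool (r = (s \<otimes> t) [^] j \<otimes> s))"
    using c by (simp add: sum.lessThan_Suc_shift del: sum.lessThan_Suc)
  finally show ?case by simp
qed simp

text \<open>Since \<open>(s \<otimes> t) [^] k = \<one>\<close>, the \<open>2 * k\<close>
  reflections of the relator are the first \<open>k\<close> listed twice.\<close>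

lemma even_refl_count_relator:
  assumes "w \<in> relators" "r \<in> carrier W" shows "even (refl_count W w r)"
proof -
  obtain s t k where st: "s \<in> S" "t \<in> S" and w: "w = concat (replicate k [(s, True), (t, True)])"
    using assms by (auto simp: coxeter_relators_def)
  have c: "s \<otimes> t \<in> carrier W" using st S_carrier by auto
  have one: "(s \<otimes> t) [^] k = \<one>"
    using ev_relator[OF assms(1)] ev_alternating[OF st] w by simp
  let ?f = "\<lambda>j. of_bool (r = (s \<otimes> t) [^] j \<otimes> s) :: nat"
  have "(\<Sum>j<2 * k. ?f j) = (\<Sum>j<k. ?f j) + (\<Sum>j<k. ?f (k + j))"
  proof -
    have "(\<Sum>j<k + n. ?f j) = (\<Sum>j<k. ?f j) + (\<Sum>j<n. ?f (k + j))" for n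
      by (induction n) auto
    then show ?thesis by (simp add: mult_2)
  qed
  also have "(\<Sum>j<k. ?f (k + j)) = (\<Sum>j<k. ?f j)"
    using c one by (intro sum.cong) (simp_all add: nat_pow_mult[symmetric])
  finally show ?thesis
    using refl_count_alternating[OF st assms(2)] w by simp
qed

text \<open>A deleted pair counts the same reflection twice, a relator counts each one evenly, and
  neither changes the conjugation seen by the remaining letters.\<close>

lemma even_refl_count:
  assumes "w \<in> words" "ev w = \<one>" "r \<in> carrier W" shows "even (refl_count W w r)"
proof -
  have "{r \<in> carrier W. odd (refl_count W w r)} = {r \<in> carrier W. odd (refl_count W [] r)}"
  proof (rule word_invariant[OF assms(1,2)])
    fix v v' assume "v \<in> words" "v' \<in> words" "word_step S relators v v'"
    from this(3,1,2)
    show "{r \<in> carrier W. odd (refl_count W v r)} = {r \<in> carrier W. odd (refl_count W v' r)}"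
    proof induction
      case (cancel x u e v)
      have "x \<otimes> (inv (ev u) \<otimes> r \<otimes> ev u) \<otimes> x = x \<longleftrightarrow> inv (ev u) \<otimes> r \<otimes> ev u = x"
        if "r \<in> carrier W" for r
        using that cancel by (subst S_conj_eq) (auto simp: S_carrier S_square)
      moreover have "x \<otimes> (x \<otimes> y \<otimes> x) \<otimes> x = y" if "y \<in> carrier W" for y
        using that cancel(1) by (simp add: S_carrier S_cancel S_square m_assoc)
      ultimately show ?case
        using cancel by (auto simp: refl_count_append)
    next
      case (relator r u v)
      then show ?case
        using relators_words[of r] ev_relator[of r]
        by (auto simp: refl_count_append even_refl_count_relator)
    qed
  qed
  with assms(3) show ?thesis by auto
qed

text \<open>For a reflection \<open>r\<close>: its wall separates \<open>K\<close> from
  \<open>xK\<close>. Every word for \<open>x\<close> gives the same parity, by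
  \<open>inverts_ev\<close>.\<close>

definition inverts :: "'g \<Rightarrow> 'g \<Rightarrow> bool" where
  "inverts x r \<longleftrightarrow> (\<exists>w\<in>words. ev w = x \<and> odd (refl_count W w r))"

lemma inverts_ev:
  assumes "w \<in> words" "r \<in> carrier W"
  shows "inverts (ev w) r \<longleftrightarrow> odd (refl_count W w r)"
proof -
  have "odd (refl_count W w r) = odd (refl_count W v r)"
    if "v \<in> words" "ev v = ev w" for v
  proof -
    have "even (refl_count W (v @ rev w) r)" "even (refl_count W (w @ rev w) r)"
      using that assms by (auto intro!: even_refl_count)
    then show ?thesis
      using that assms by (simp add: refl_count_append)
  qed
  with assms(1) show ?thesis unfolding inverts_def by blast
qed

lemma inverts_one: "r \<in> carrier W \<Longrightarrow> \<not> inverts \<one> r"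
  using inverts_ev[of "[]" r] by simp

lemma inverts_gen: "a \<in> S \<Longrightarrow> r \<in> carrier W \<Longrightarrow> inverts a r \<longleftrightarrow> r = a"
  using inverts_ev[of "[(a, True)]" r] by (simp add: S_carrier)

text \<open>Cocycle rule: a gallery from \<open>K\<close> to \<open>xyK\<close> may pass through
  \<open>xK\<close>; translating its second part back by \<open>x\<close> conjugates
  \<open>r\<close>.\<close>

lemma inverts_mult:
  assumes "x \<in> carrier W" "y \<in> carrier W" "r \<in> carrier W"
  shows "inverts (x \<otimes> y) r \<longleftrightarrow> inverts x r \<noteq> inverts y (inv x \<otimes> r \<otimes> x)"
proof -
  obtain u v where "u \<in> words" "ev u = x" "v \<in> words" "ev v = y"
    using ex_word assms by meson
  then show ?thesis
    using inverts_ev[of "u @ v" r] inverts_ev[of u r] inverts_ev[of v "inv x \<otimes> r \<otimes> x"] assms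
    by (auto simp: refl_count_append)
qed

text \<open>Strong exchange: deleting a letter at which \<open>r\<close> is counted multiplies the
  value by \<open>r\<close> on the left.\<close>

lemma refl_count_pos_shorten:
  assumes "w \<in> words" "r \<in> carrier W" "refl_count W w r \<noteq> 0"
  shows "\<exists>v\<in>words. length v < length w \<and> ev v = r \<otimes> ev w"
  using assms
proof (induction w arbitrary: r)
  case (Cons a w)
  then have a: "fst a \<in> S" "w \<in> words" "fst a \<in> S" by auto
  show ?case
  proof (cases "r = fst a")
    case True
    then show ?thesis using a by (intro bexI[of _ w]) (auto simp: S_cancel)
  next
    case False
    then obtain v where v: "v \<in> words" "length v < length w" "ev v = (fst a \<otimes> r \<otimes> fst a) \<otimes> ev w"
      using Cons.IH[of "fst a \<otimes> r \<otimes> fst a"] Cons.prems a by (auto simp: S_carrier)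
    have "ev (a # v) = r \<otimes> ev (a # w)"
      using a v Cons.prems by (simp add: S_carrier S_cancel m_assoc)
    with v a show ?thesis by (intro bexI[of _ "a # v"]) auto
  qed
qed simp

lemma inverts_shorten:
  assumes "x \<in> carrier W" "r \<in> carrier W" "inverts x r" shows "len (r \<otimes> x) < len x"
proof -
  obtain w where w: "w \<in> words" "ev w = x" "length w = len x"
    using ex_min_word[OF assms(1)] .
  with inverts_ev[of w r] assms have "refl_count W w r \<noteq> 0" by (metis even_zero)
  with w assms refl_count_pos_shorten[of w r] len_le show ?thesis by (metis le_less_trans)
qed

lemma inverts_gen_mult:
  assumes "s \<in> S" "x \<in> carrier W" shows "inverts (s \<otimes> x) s \<longleftrightarrow> \<not> inverts x s"
  using assms inverts_mult[of s x s] by (simp add: S_carrier S_inv S_square inverts_gen)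

text \<open>Exactly one of \<open>x\<close> and \<open>s \<otimes> x\<close> inverts
  \<open>s\<close>, and that one is the longer. This turns roots into inversion conditions.\<close>

lemma inverts_iff_len:
  assumes "s \<in> S" "x \<in> carrier W" shows "inverts x s \<longleftrightarrow> len (s \<otimes> x) < len x"
  using inverts_shorten[of x s] inverts_shorten[of "s \<otimes> x" s] inverts_gen_mult[of s x] assms
  by (auto simp: S_carrier S_cancel)

lemma not_inverts_iff_len:
  assumes "s \<in> S" "x \<in> carrier W" shows "\<not> inverts x s \<longleftrightarrow> len x < len (s \<otimes> x)"
  using inverts_iff_len[of s "s \<otimes> x"] inverts_gen_mult[of s x] assms
  by (auto simp: S_carrier S_cancel)

subsection \<open>The geometric representation\<close>

text \<open>
  The dual of the usual representation, acting on functions on the generators: the dihedral relations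
  then only involve the values at \<open>s\<close> and \<open>t\<close> and the sums of the successive values there.
\<close>

definition coxeter_form :: "'g \<Rightarrow> 'g \<Rightarrow> real" where
  "coxeter_form s r =
     (if r = s then 2 else case m s r of enat n \<Rightarrow> - 2 * cos (pi / n) | \<infinity> \<Rightarrow> - 2)"

text \<open>\<open>f\<close> records the values of a linear functional on the simple roots, and
  \<open>coxeter_form\<close> is twice the usual bilinear form on them; the functional is composed
  with the reflection in the root of \<open>s\<close>.\<close>

definition reflect :: "'g \<Rightarrow> ('g \<Rightarrow> real) \<Rightarrow> 'g \<Rightarrow> real" where
  "reflect s f = (\<lambda>r. f r - coxeter_form s r * f s)"

abbreviation word_act :: "('g \<times> bool) list \<Rightarrow> ('g \<Rightarrow> real) \<Rightarrow> 'g \<Rightarrow> real" where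
  "word_act \<equiv> foldr (\<lambda>a. reflect (fst a))"

lemma reflect_reflect: "reflect s (reflect s f) = f"
  by (auto simp: reflect_def coxeter_form_def)

text \<open>The rightmost letter \<open>t\<close> acts first. Even terms of \<open>z\<close> are the
  values at \<open>t\<close> when \<open>t\<close> acts, odd terms the values at \<open>s\<close>
  when \<open>s\<close> acts.\<close>

lemma word_act_alternating:
  assumes "s \<noteq> t" and c: "coxeter_form s t = - c" "coxeter_form t s = - c"
    and z: "z 0 = f t" "z 1 = f s + c * f t" "\<And>k. z (Suc (Suc k)) = c * z (Suc k) - z k"
  shows "word_act (concat (replicate k [(s, True), (t, True)])) f = (\<lambda>r. f r
    - coxeter_form t r * (\<Sum>i<k. z (2 * i)) - coxeter_form s r * (\<Sum>i<k. z (2 * i + 1)))"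
    (is "?F k = ?R k")
    and "word_act (concat (replicate k [(s, True), (t, True)])) f t = z (2 * k)"
    and "word_act (concat (replicate k [(s, True), (t, True)])) f s = z (2 * k + 1) - c * z (2 * k)"
proof -
  have d: "coxeter_form s s = 2" "coxeter_form t t = 2"
    by (simp_all add: coxeter_form_def)
  have "?F k = ?R k \<and> ?F k t = z (2 * k) \<and> ?F k s = z (2 * k + 1) - c * z (2 * k)"
  proof (induction k)
    case 0
    then show ?case using z by simp
  next
    case (Suc k)
    have F: "?F (Suc k) = reflect s (reflect t (?F k))" by simp
    have Ft: "?F k t = z (2 * k)" and Fs: "?F k s = z (2 * k + 1) - c * z (2 * k)"
      using Suc by blast+
    then have t: "reflect t (?F k) = (\<lambda>r. ?F k r - coxeter_form t r * z (2 * k))"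
      by (simp only: reflect_def)
    then have "reflect t (?F k) s = ?F k s - coxeter_form t s * z (2 * k)"
      by (simp only:)
    then have ts: "reflect t (?F k) s = z (2 * k + 1)" using Fs c by simp
    then have F': "?F (Suc k) r = ?F k r - coxeter_form t r * z (2 * k) - coxeter_form s r * z (2 * k + 1)" for r
    proof -
      have "?F (Suc k) r = reflect t (?F k) r - coxeter_form s r * z (2 * k + 1)"
        by (simp only: F reflect_def[of s "reflect t (?F k)"] ts)
      then show ?thesis by (simp only: t)
    qed
    have "?F (Suc k) = ?R (Suc k)"
    proof
      fix r
      have "?F k r = ?R k r" using Suc by metis
      then show "?F (Suc k) r = ?R (Suc k) r"
        unfolding F' by (simp add: algebra_simps)
    qed
    moreover have "?F (Suc k) t = z (2 * Suc k)"
      unfolding F' using Ft c d z(3)[of "2 * k"] by simp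
    moreover have "?F (Suc k) s = z (2 * Suc k + 1) - c * z (2 * Suc k)"
      unfolding F' using Fs c d z(3)[of "2 * k + 1"] by simp
    ultimately show ?case by blast
  qed
  then show "?F k = ?R k" "?F k t = z (2 * k)" "?F k s = z (2 * k + 1) - c * z (2 * k)"
    by blast+
qed

fun recurrence :: "real \<Rightarrow> real \<Rightarrow> real \<Rightarrow> nat \<Rightarrow> real" where
  "recurrence c x y 0 = x"
| "recurrence c x y (Suc 0) = y"
| "recurrence c x y (Suc (Suc k)) = c * recurrence c x y (Suc k) - recurrence c x y k"

text \<open>For \<open>s \<noteq> t\<close> the multiplier is \<open>2 * cos (pi / k)\<close>, so
  both correction sums run over a full period and vanish.\<close>

lemma word_act_relator:
  assumes "w \<in> relators" shows "word_act w f = f"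
proof -
  obtain s t k where st: "s \<in> S" "t \<in> S" and k: "m s t = enat k"
    and w: "w = concat (replicate k [(s, True), (t, True)])"
    using assms by (auto simp: coxeter_relators_def)
  show ?thesis
  proof (cases "s = t")
    case True
    with k st m_diag[of s] have "k = 1" by (simp add: one_enat_def)
    with True w show ?thesis by (simp add: reflect_reflect)
  next
    case False
    with st k m_ge_2[of s t] have "2 \<le> k" by (simp add: numeral_eq_enat)
    define c where "c = 2 * cos (pi / k)"
    define z where "z = recurrence c (f t) (f s + c * f t)"
    have z: "z 0 = f t" "z 1 = f s + c * f t" "\<And>k. z (Suc (Suc k)) = c * z (Suc k) - z k"
      by (simp_all add: z_def)
    have "coxeter_form s t = - c" "coxeter_form t s = - c"
      using False k st m_sym[of s t] by (auto simp: coxeter_form_def c_def)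
    note F = word_act_alternating(1)[OF False this z]
    have "(\<Sum>i<k. z (2 * i)) = 0" "(\<Sum>i<k. z (2 * i + 1)) = 0"
      using z(3) \<open>2 \<le> k\<close>
      by (auto intro!: linear_recurrence_periodic(2,3) simp: c_def simp del: One_nat_def)
    with F w show ?thesis by simp
  qed
qed

lemma word_act_trivial:
  assumes "w \<in> words" "ev w = \<one>" shows "word_act w f = f"
proof -
  have "word_act w = word_act []"
  proof (rule word_invariant[OF assms])
    fix v v' assume "word_step S relators v v'"
    then show "word_act v = word_act v'"
      by induction (auto simp: reflect_reflect word_act_relator)
  qed
  then show ?thesis by simp
qed

text \<open>For label \<open>\<infinity>\<close> the multiplier is 2 and the recurrence has the
  unbounded solution \<open>real\<close>, so the value at \<open>t\<close> becomes
  \<open>2 * k\<close> instead of staying 0.\<close>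

lemma infinite_order:
  assumes "s \<in> S" "t \<in> S" "m s t = \<infinity>" "(s \<otimes> t) [^] (k :: nat) = \<one>" shows "k = 0"
proof -
  have "s \<noteq> t" using assms m_diag[of s] by auto
  define f where "f r = (of_bool (r = s) :: real)" for r
  have "word_act (concat (replicate k [(s, True), (t, True)])) f t = real (2 * k)"
  proof (rule word_act_alternating(2)[OF \<open>s \<noteq> t\<close>, where c = 2 and z = real])
    show "coxeter_form s t = - 2" "coxeter_form t s = - 2"
      using assms \<open>s \<noteq> t\<close> m_sym[of s t] by (auto simp: coxeter_form_def)
  qed (use \<open>s \<noteq> t\<close> in \<open>auto simp: f_def\<close>)
  moreover have "word_act (concat (replicate k [(s, True), (t, True)])) f = f"
    using assms by (intro word_act_trivial) (auto simp: ev_alternating)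
  ultimately show ?thesis using \<open>s \<noteq> t\<close> by (simp add: f_def)
qed

lemma not_commute:
  assumes "s \<in> S" "t \<in> S" "s \<noteq> t" "m s t \<noteq> 2" shows "s \<otimes> t \<noteq> t \<otimes> s"
proof
  assume "s \<otimes> t = t \<otimes> s"
  then have "(s \<otimes> t) [^] (2 :: nat) = (s \<otimes> t) \<otimes> (t \<otimes> s)"
    using assms S_carrier by (simp add: numeral_2_eq_2)
  then have "(s \<otimes> t) [^] (2 :: nat) = \<one>"
    using assms by (simp add: S_carrier S_square m_assoc S_cancel)
  then have triv: "word_act (concat (replicate 2 [(s, True), (t, True)])) f = f" for f
    using assms by (intro word_act_trivial) (auto simp: ev_alternating)
  define c where "c = - coxeter_form s t"
  have c: "coxeter_form s t = - c" "coxeter_form t s = - c"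
    using assms m_sym[of s t] by (auto simp: coxeter_form_def c_def)
  have "c > 0"
  proof (cases "m s t")
    case (enat n)
    with assms m_ge_2[of s t] have "2 < n"
      by (auto simp: numeral_eq_enat le_less)
    then have "0 < cos (pi / n)"
      by (intro cos_gt_zero) (auto simp: field_simps)
    then show ?thesis using enat assms by (simp add: c_def coxeter_form_def)
  next
    case infinity
    then show ?thesis using assms by (simp add: c_def coxeter_form_def)
  qed
  define f where "f r = (of_bool (r = s) :: real)" for r
  define z where "z = recurrence c (f t) (f s + c * f t)"
  have "word_act (concat (replicate 2 [(s, True), (t, True)])) f t = z (2 * 2)"
       "word_act (concat (replicate 2 [(s, True), (t, True)])) f s = z (2 * 2 + 1) - c * z (2 * 2)"
    using word_act_alternating(2,3)[OF \<open>s \<noteq> t\<close> c, of z f 2] by (simp_all add: z_def)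
  then have "z 4 = 0" "z 5 = 1"
    unfolding triv using \<open>s \<noteq> t\<close> by (auto simp: f_def)
  \<comment> \<open>The first equation forces \<open>c * c = 2\<close>; the second would then read
    \<open>-1 = 1\<close>.\<close>
  then have "c * (c * c - 2) = 0" "c * (c * (c * c - 2)) - (c * c - 1) = 1"
    using \<open>s \<noteq> t\<close> by (auto simp: z_def f_def eval_nat_numeral algebra_simps)
  with \<open>c > 0\<close> show False by auto
qed

subsection \<open>Infinite dihedral subgroups and the centralizer of a generator\<close>

text \<open>
  Left multiplication by \<open>s\<close> and \<open>u\<close> acts on the indices \<open>j\<close> of the reflections \<open>(su)\<^sup>j s\<close> by the
  two reflections of the integers about \<open>0\<close> and \<open>-1\<close>, which permute the intervals between \<open>0\<close>
  and \<open>k\<close>.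
\<close>

lemma inverts_dihedral:
  assumes "s \<in> S" "u \<in> S" "m s u = \<infinity>" "h \<in> generate W {s, u}" "y \<in> carrier W"
    and "\<And>j :: int. inverts y ((s \<otimes> u) [^] j \<otimes> s) \<longleftrightarrow> 0 \<le> j \<and> j < k \<or> k \<le> j \<and> j < 0"
  shows "\<exists>k. \<forall>j :: int. inverts (h \<otimes> y) ((s \<otimes> u) [^] j \<otimes> s) \<longleftrightarrow> 0 \<le> j \<and> j < k \<or> k \<le> j \<and> j < 0"
proof -
  define q where "q = s \<otimes> u"
  have c: "s \<in> carrier W" "u \<in> carrier W" "q \<in> carrier W"
    using assms S_carrier by (auto simp: q_def)
  \<comment> \<open>Infinite order makes the index of each reflection \<open>p j\<close> unique, so
    \<open>s\<close> and \<open>u\<close> each toggle a single index.\<close>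
  have q_one: "q [^] j = \<one> \<Longrightarrow> j = 0" for j :: int
  proof -
    assume "q [^] j = \<one>"
    then have "q [^] nat \<bar>j\<bar> = \<one>"
      using c by (cases j rule: int_cases2) (simp_all add: int_pow_int int_pow_neg_int)
    then have "nat \<bar>j\<bar> = 0"
      unfolding q_def by (rule infinite_order[OF assms(1-3)])
    then show "j = 0" by simp
  qed
  have inv_q: "inv q = u \<otimes> s"
    using assms by (simp add: q_def inv_mult_group S_inv S_carrier)
  have sq: "s \<otimes> q = inv q \<otimes> s" "s \<otimes> inv q = q \<otimes> s"
    unfolding inv_q using assms by (simp_all add: q_def S_carrier S_cancel S_square m_assoc)
  have s_pow: "s \<otimes> q [^] j = q [^] (- j) \<otimes> s" for j :: int
  proof (induction j rule: int_induct[where k = 0])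
    case base
    then show ?case using c by simp
  next
    case (step1 j)
    have "s \<otimes> q [^] (j + 1) = (s \<otimes> q [^] j) \<otimes> q"
      using c by (simp add: int_pow_mult m_assoc)
    also have "\<dots> = (q [^] (- j) \<otimes> inv q) \<otimes> s"
      using c step1 sq by (simp add: m_assoc)
    also have "q [^] (- j) \<otimes> inv q = q [^] (- (j + 1))"
      using int_pow_diff[of q "- j" 1] c by simp
    finally show ?case .
  next
    case (step2 j)
    have "s \<otimes> q [^] (j - 1) = (s \<otimes> q [^] j) \<otimes> inv q"
      using c by (simp add: int_pow_diff m_assoc)
    also have "\<dots> = (q [^] (- j) \<otimes> q) \<otimes> s"
      using c step2 sq by (simp add: m_assoc)
    also have "q [^] (- j) \<otimes> q = q [^] (- (j - 1))"
      using int_pow_mult[of q "- j" 1] c by (simp add: add.commute)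
    finally show ?case .
  qed
  define p where "p j = q [^] j \<otimes> s" for j :: int
  have p: "p j \<in> carrier W" for j using c by (simp add: p_def)
  have u: "u = inv q \<otimes> s"
    unfolding inv_q using assms by (simp add: m_assoc S_carrier S_square)
  have ps: "s \<otimes> p j \<otimes> s = p (- j)" for j
    using assms c by (simp add: p_def m_assoc S_square s_pow[symmetric])
  have pu: "u \<otimes> p j \<otimes> u = p (- 2 - j)" for j
  proof -
    have "u \<otimes> p j \<otimes> u = inv q \<otimes> (s \<otimes> q [^] j) \<otimes> s \<otimes> u"
      using c unfolding p_def by (simp add: u m_assoc)
    also have "\<dots> = inv q \<otimes> q [^] (- j) \<otimes> (s \<otimes> s) \<otimes> inv q \<otimes> s"
      using c by (simp add: s_pow u m_assoc)
    also have "\<dots> = inv q \<otimes> q [^] (- j) \<otimes> inv q \<otimes> s"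
      using assms c by (simp add: S_square)
    also have "inv q \<otimes> q [^] (- j) \<otimes> inv q = q [^] (- 1 + - j - 1)"
      using c by (simp only: int_pow_mult int_pow_diff int_pow_neg int_pow_1)
    finally show ?thesis by (simp add: p_def)
  qed
  have p0: "p j = s \<longleftrightarrow> j = 0" for j
    using c q_one[of j] by (auto simp: p_def)
  have p1: "p j = u \<longleftrightarrow> j = - 1" for j
  proof
    assume "p j = u"
    then have "q [^] j = inv q" using c by (simp add: p_def u)
    then have "q [^] (j + 1) = \<one>" using c by (simp add: int_pow_mult)
    then show "j = - 1" using q_one[of "j + 1"] by simp
  next
    assume "j = - 1"
    then show "p j = u" using c by (simp add: p_def u int_pow_neg)
  qed
  have s_step: "inverts (s \<otimes> x) (p j) \<longleftrightarrow> (j = 0) \<noteq> inverts x (p (- j))"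
    and u_step: "inverts (u \<otimes> x) (p j) \<longleftrightarrow> (j = - 1) \<noteq> inverts x (p (- 2 - j))"
    if "x \<in> carrier W" for x j
    using that c p assms by (auto simp: inverts_mult inverts_gen S_inv ps pu p0 p1)
  define I where "I x \<longleftrightarrow> (\<exists>k. \<forall>j. inverts x (p j) \<longleftrightarrow> 0 \<le> j \<and> j < k \<or> k \<le> j \<and> j < 0)" for x
  have gen: "I (a \<otimes> x)" if "a \<in> {s, u}" "x \<in> carrier W" "I x" for a x
  proof -
    from \<open>I x\<close> obtain k where k: "\<And>j. inverts x (p j) \<longleftrightarrow> 0 \<le> j \<and> j < k \<or> k \<le> j \<and> j < 0"
      by (auto simp: I_def)
    \<comment> \<open>Reflecting the indices and toggling 0 or \<open>-1\<close> sends the interval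
      of \<open>k\<close> to that of \<open>1 - k\<close> or \<open>- 1 - k\<close>.\<close>
    have "inverts (s \<otimes> x) (p j) \<longleftrightarrow> 0 \<le> j \<and> j < 1 - k \<or> 1 - k \<le> j \<and> j < 0"
      and "inverts (u \<otimes> x) (p j) \<longleftrightarrow> 0 \<le> j \<and> j < - 1 - k \<or> - 1 - k \<le> j \<and> j < 0" for j
      unfolding s_step[OF that(2)] u_step[OF that(2)] k by presburger+
    with that(1) show ?thesis unfolding I_def by blast
  qed
  have "\<forall>x. x \<in> carrier W \<longrightarrow> I x \<longrightarrow> I (h \<otimes> x)"
    using assms(4)
  proof induction
    case (eng h1 h2)
    have "h1 \<in> carrier W" "h2 \<in> carrier W"
      using eng generate_in_carrier[of "{s, u}"] c by auto
    with eng show ?case by (auto simp: m_assoc)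
  qed (use gen assms in \<open>auto simp: S_inv\<close>)
  moreover have "I y"
    using assms(6) unfolding I_def p_def q_def by blast
  ultimately show ?thesis
    using assms(5) unfolding I_def p_def q_def by blast
qed

text \<open>
  In a coset \<open>\<langle>s, u\<rangle>x\<close> an element of minimal length is inverted by no reflection of
  \<open>\<langle>s, u\<rangle>\<close>, so the reflections of \<open>\<langle>s, u\<rangle>\<close> inverting \<open>x\<close> form an interval ending at
  \<open>s\<close> or at \<open>u\<close>.
\<close>

lemma not_inverts_both:
  assumes "s \<in> S" "u \<in> S" "m s u = \<infinity>" "x \<in> carrier W" "inverts x s"
  shows "\<not> inverts x u"
proof -
  let ?H = "generate W {s, u}"
  have c: "s \<in> carrier W" "u \<in> carrier W" using assms S_carrier by auto
  then have H: "subgroup ?H W" by (intro generate_is_subgroup) auto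
  obtain h where h: "h \<in> ?H" and min: "\<And>h'. h' \<in> ?H \<Longrightarrow> len (h \<otimes> x) \<le> len (h' \<otimes> x)"
    using ex_has_least_nat[of "\<lambda>h. h \<in> ?H" \<one> "\<lambda>h. len (h \<otimes> x)"] subgroup.one_closed[OF H] by blast
  have hc: "h \<in> carrier W" using subgroup.mem_carrier[OF H h] .
  have "\<not> inverts (h \<otimes> x) ((s \<otimes> u) [^] j \<otimes> s)" for j :: int
  proof
    assume inv: "inverts (h \<otimes> x) ((s \<otimes> u) [^] j \<otimes> s)"
    have r: "(s \<otimes> u) [^] j \<otimes> s \<in> ?H"
      using H by (intro subgroup.m_closed subgroup_int_pow_closed) (auto intro: generate.incl)
    then have "len (((s \<otimes> u) [^] j \<otimes> s) \<otimes> (h \<otimes> x)) < len (h \<otimes> x)"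
      using inv hc c assms by (intro inverts_shorten) auto
    moreover have "((s \<otimes> u) [^] j \<otimes> s) \<otimes> h \<in> ?H"
      using subgroup.m_closed[OF H r h] .
    ultimately show False
      using min[of "((s \<otimes> u) [^] j \<otimes> s) \<otimes> h"] hc c assms by (simp add: m_assoc)
  qed
  then have "\<exists>k. \<forall>j :: int. inverts (inv h \<otimes> (h \<otimes> x)) ((s \<otimes> u) [^] j \<otimes> s) \<longleftrightarrow>
      0 \<le> j \<and> j < k \<or> k \<le> j \<and> j < 0"
    using hc h H assms
    by (intro inverts_dihedral[where k = 0]) (auto intro: subgroup.m_inv_closed)
  moreover have "inv h \<otimes> (h \<otimes> x) = x"
    using hc assms by (simp add: m_assoc[symmetric])
  ultimately obtain k where
    k: "\<And>j :: int. inverts x ((s \<otimes> u) [^] j \<otimes> s) \<longleftrightarrow> 0 \<le> j \<and> j < k \<or> k \<le> j \<and> j < 0"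
    by auto
  \<comment> \<open>\<open>s\<close> has index 0 and \<open>u\<close> has index \<open>-1\<close>;
    no interval of the given form contains both.\<close>
  have "(s \<otimes> u) [^] (- 1 :: int) \<otimes> s = u"
    using c assms by (simp add: int_pow_neg inv_mult_group S_inv S_square m_assoc)
  with k[of 0] k[of "- 1"] c assms show ?thesis by simp
qed

text \<open>The parity of the number of letters \<open>s\<close> in a word is invariant because every finite \<open>m\<^sub>s\<^sub>u\<close> with \<open>u \<noteq> s\<close> is even.\<close>

lemma conjugate_to_gen_eq:
  assumes "\<forall>u\<in>S - {s}. m s u \<in> {2, \<infinity>}" "s \<in> S" "u \<in> S" "x \<in> carrier W"
    and "x \<otimes> u \<otimes> inv x = s"
  shows "u = s"
proof -
  define F where "F w = even (count_list (map fst w) s)" for w :: "('g \<times> bool) list"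
  have rel: "F r" if r: "r \<in> relators" for r
  proof -
    obtain a b k where ab: "a \<in> S" "b \<in> S" "m a b = enat k"
      and w: "r = concat (replicate k [(a, True), (b, True)])"
      using r by (auto simp: coxeter_relators_def)
    have "count_list (map fst r) s = k * (of_bool (a = s) + of_bool (b = s))"
      unfolding w by (induction k) auto
    moreover have "even k" if "a \<noteq> b" "a = s \<or> b = s"
      using that ab assms(1) m_sym[of a b] by (force simp: numeral_eq_enat)
    ultimately show ?thesis unfolding F_def by auto
  qed
  obtain w where w: "w \<in> words" "ev w = x" using ex_word assms by blast
  \<comment> \<open>In this trivial word \<open>w\<close> and its reverse contribute evenly many
    letters \<open>s\<close>, so the final \<open>s\<close> can only be balanced by
    \<open>u = s\<close>.\<close>
  have "ev (w @ [(u, True)] @ rev w @ [(s, True)]) = (x \<otimes> u \<otimes> inv x) \<otimes> s"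
    using w assms(2-4) by (simp add: S_carrier m_assoc)
  also have "\<dots> = \<one>" using assms S_square by simp
  finally have "F (w @ [(u, True)] @ rev w @ [(s, True)]) = F []"
  proof (rule word_invariant[rotated])
    fix v v' assume "word_step S relators v v'"
    then show "F v = F v'"
      by induction (use rel in \<open>auto simp: F_def\<close>)
  qed (use w assms in auto)
  then show ?thesis
    by (auto simp: F_def rev_map[symmetric] split: if_splits)
qed

text \<open>Induction on length, stripping a left descent \<open>u\<close> of \<open>w\<close>. If
  \<open>u\<close> does not commute with \<open>s\<close>, its label is \<open>\<infinity>\<close>
  and \<open>s\<close> itself must be a left descent; otherwise \<open>s \<otimes> w\<close> would
  invert both \<open>s\<close> and \<open>u\<close>.\<close>

lemma centralizer_generated:
  assumes "\<forall>u\<in>S - {s}. m s u \<in> {2, \<infinity>}" "s \<in> S" "w \<in> carrier W" "s \<otimes> w = w \<otimes> s"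
  shows "w \<in> generate W {u \<in> S. u \<otimes> s = s \<otimes> u}"
  using assms(3,4)
proof (induction "len w" arbitrary: w rule: less_induct)
  case less
  note c = S_carrier[OF \<open>s \<in> S\<close>]
  let ?Z = "generate W {u \<in> S. u \<otimes> s = s \<otimes> u}"
  have descend: "w \<in> ?Z" if u: "u \<in> S" "u \<otimes> s = s \<otimes> u" "len (u \<otimes> w) < len w" for u
  proof -
    have "s \<otimes> (u \<otimes> w) = (u \<otimes> s) \<otimes> w"
      using u less.prems(1) c by (simp add: S_carrier m_assoc)
    also have "\<dots> = (u \<otimes> w) \<otimes> s"
      using u(1) less.prems c by (simp add: S_carrier m_assoc)
    finally have "u \<otimes> w \<in> ?Z"
      using less.hyps[of "u \<otimes> w"] u less.prems by (simp add: S_carrier)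
    then have "u \<otimes> (u \<otimes> w) \<in> ?Z"
      using u by (auto intro: generate.eng generate.incl)
    then show ?thesis using u less.prems by (simp add: S_cancel)
  qed
  show ?case
  proof (cases "w = \<one>")
    case True
    then show ?thesis by (simp add: generate.one)
  next
    case False
    with less.prems obtain u where u: "u \<in> S" "len (u \<otimes> w) < len w"
      using ex_left_descent by metis
    show ?thesis
    proof (cases "u \<otimes> s = s \<otimes> u")
      case True
      with u descend show ?thesis by blast
    next
      case False
      have "m s u \<noteq> 2"
      proof
        assume 2: "m s u = 2"
        then have "concat (replicate 2 [(s, True), (u, True)]) \<in> relators"
          using u assms unfolding coxeter_relators_def by (force simp: numeral_eq_enat)
        then have "(s \<otimes> u) [^] (2 :: nat) = \<one>"
          using ev_relator ev_alternating u assms by metis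
        then have "(s \<otimes> u) \<otimes> (s \<otimes> u) = \<one>"
          using c u S_carrier by (simp add: numeral_2_eq_2)
        then have "inv (s \<otimes> u) = s \<otimes> u"
          using c u S_carrier by (intro inv_equality) auto
        then show False
          using False c u assms by (simp add: inv_mult_group S_inv S_carrier)
      qed
      then have inf: "m s u = \<infinity>" using assms(1) u False by auto
      have "len (s \<otimes> w) < len w"
      proof (rule ccontr)
        assume "\<not> len (s \<otimes> w) < len w"
        then have "\<not> inverts w s" using inverts_iff_len less.prems assms by blast
        then have "inverts (s \<otimes> w) s" and lt: "len w < len (s \<otimes> w)"
          using inverts_gen_mult not_inverts_iff_len less.prems assms by blast+
        have "len (u \<otimes> (s \<otimes> w)) = len ((u \<otimes> w) \<otimes> s)"
          using less.prems u c by (simp add: S_carrier m_assoc)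
        also have "\<dots> \<le> Suc (len (u \<otimes> w))"
          using less.prems u assms by (intro len_mult_right) (auto simp: S_carrier)
        finally have "len (u \<otimes> (s \<otimes> w)) < len (s \<otimes> w)" using u lt by linarith
        then have "inverts (s \<otimes> w) u"
          using inverts_iff_len u less.prems c by simp
        with \<open>inverts (s \<otimes> w) s\<close> show False
          using not_inverts_both[OF assms(2) u(1) inf, of "s \<otimes> w"] less.prems c by simp
      qed
      then show ?thesis using descend[of s] assms by simp
    qed
  qed
qed

text \<open>
  The half-space \<open>h \<sdot> H\<^sub>s\<^sup>+\<close> is connected to \<open>h\<close> by galleries; if it meets the other side of \<open>H\<^sub>s\<close>,
  then some gallery crosses \<open>H\<^sub>s\<close>, necessarily along a panel of type \<open>s\<close>.
\<close>

lemma halfspace_crosses_wall: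
  assumes "\<forall>u\<in>S - {s}. m s u \<in> {2, \<infinity>}" "s \<in> S" "h \<in> carrier W" "a \<in> carrier W"
    and "\<not> inverts a s" "inverts (h \<otimes> a) s \<noteq> inverts h s"
  shows "\<exists>y\<in>carrier W. s \<otimes> y = y \<otimes> s \<and> \<not> inverts (inv h \<otimes> y) s"
  using assms(4-6)
proof (induction "len a" arbitrary: a rule: less_induct)
  case less
  note c = S_carrier[OF \<open>s \<in> S\<close>] \<open>h \<in> carrier W\<close> \<open>a \<in> carrier W\<close>
  have "a \<noteq> \<one>" using less.prems c by auto
  then obtain z where z: "z \<in> S" "len (a \<otimes> z) < len a"
    using ex_right_descent less.prems by metis
  let ?a = "a \<otimes> z"
  have zc: "z \<in> carrier W" "?a \<in> carrier W" using z c S_carrier by auto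
  have az: "?a \<otimes> z = a" using z c zc by (simp add: m_assoc S_square)
  \<comment> \<open>The shorter \<open>?a\<close> stays in the positive root, since right
    multiplication by \<open>z\<close> lengthens by at most one.\<close>
  have "len a < len (s \<otimes> a)" using not_inverts_iff_len less.prems assms by blast
  also have "s \<otimes> a = (s \<otimes> ?a) \<otimes> z" using z c zc by (simp add: m_assoc S_square)
  also have "len \<dots> \<le> Suc (len (s \<otimes> ?a))" using z c zc by (intro len_mult_right) auto
  finally have "len ?a < len (s \<otimes> ?a)" using z by linarith
  then have na: "\<not> inverts ?a s" using not_inverts_iff_len zc assms by blast
  show ?case
  proof (cases "inverts (h \<otimes> ?a) s = inverts h s")
    case False
    then show ?thesis using less.hyps[of ?a] z zc na by blast
  next
    case True
    let ?y = "h \<otimes> ?a"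
    have y: "?y \<in> carrier W" using c zc by auto
    have "?y \<otimes> z = h \<otimes> a" using c zc az by (simp add: m_assoc)
    then have "inverts (?y \<otimes> z) s \<noteq> inverts ?y s" using True less.prems by simp
    \<comment> \<open>The step from \<open>?y\<close> to \<open>?y \<otimes> z\<close> crosses the
      wall, so \<open>s\<close> fixes its panel; thus \<open>z\<close> is conjugate to
      \<open>s\<close> and equals it.\<close>
    then have "inverts z (inv ?y \<otimes> s \<otimes> ?y)" using y c zc by (auto simp: inverts_mult)
    then have "inv ?y \<otimes> s \<otimes> ?y = z" using y c z by (auto simp: inverts_gen)
    then have sy: "s \<otimes> ?y = ?y \<otimes> z" using y c zc by (metis inv_solve_left' m_assoc m_closed inv_closed)
    then have "?y \<otimes> z \<otimes> inv ?y = s" using y c zc by (metis inv_solve_right' m_closed)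
    then have "z = s" using conjugate_to_gen_eq[OF assms(1,2) z(1) y] by simp
    moreover have "inv h \<otimes> ?y = ?a" using c zc by (simp add: m_assoc[symmetric])
    ultimately show ?thesis using sy y na by auto
  qed
qed

text \<open>Right multiplication by a generator \<open>u\<close> commuting with \<open>s\<close>
  moves \<open>g \<otimes> c\<close> across the wall only if
  \<open>s \<otimes> (g \<otimes> c) = (g \<otimes> c) \<otimes> u\<close>. Then
  \<open>u = s\<close>, so \<open>s\<close> would commute with \<open>g \<otimes> c\<close> and
  hence with \<open>g\<close>.\<close>

lemma inverts_constant_on_centralizer:
  assumes "\<forall>u\<in>S - {s}. m s u \<in> {2, \<infinity>}" "s \<in> S" "g \<in> carrier W" "s \<otimes> g \<noteq> g \<otimes> s"
    and "d \<in> generate W {u \<in> S. u \<otimes> s = s \<otimes> u}" "c \<in> carrier W" "s \<otimes> c = c \<otimes> s"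
  shows "inverts (g \<otimes> (c \<otimes> d)) s = inverts (g \<otimes> c) s"
proof -
  let ?C = "\<lambda>c. c \<in> carrier W \<and> s \<otimes> c = c \<otimes> s"
  have s: "s \<in> carrier W" using S_carrier assms by blast
  have C_mult: "?C (x \<otimes> y)" if "?C x" "?C y" for x y
    using that s by (metis m_assoc m_closed)
  have gen: "?C u \<and> (\<forall>c. ?C c \<longrightarrow> inverts (g \<otimes> (c \<otimes> u)) s = inverts (g \<otimes> c) s)"
    if u: "u \<in> S" "u \<otimes> s = s \<otimes> u" for u
  proof (intro conjI allI impI)
    show "u \<in> carrier W" "s \<otimes> u = u \<otimes> s" using u S_carrier by auto
    fix c assume c: "?C c"
    let ?y = "g \<otimes> c"
    have y: "?y \<in> carrier W" using c assms by simp
    have "inv ?y \<otimes> s \<otimes> ?y \<noteq> u"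
    proof
      assume "inv ?y \<otimes> s \<otimes> ?y = u"
      then have sy: "s \<otimes> ?y = ?y \<otimes> u"
        using y s u S_carrier inv_solve_left'[of u ?y "s \<otimes> ?y"] by (simp add: m_assoc)
      then have "?y \<otimes> u \<otimes> inv ?y = s"
        using y s u S_carrier inv_solve_right'[of s "?y \<otimes> u" ?y] by simp
      then have "u = s" using conjugate_to_gen_eq[OF assms(1,2) u(1) y] by simp
      then have "(s \<otimes> g) \<otimes> c = (g \<otimes> s) \<otimes> c"
        using sy c s assms by (simp add: m_assoc)
      then show False using c s assms by simp
    qed
    then have "inverts (?y \<otimes> u) s = inverts ?y s"
      using y s u S_carrier by (auto simp: inverts_mult inverts_gen)
    moreover have "?y \<otimes> u = g \<otimes> (c \<otimes> u)"
      using c u assms S_carrier by (simp add: m_assoc)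
    ultimately show "inverts (g \<otimes> (c \<otimes> u)) s = inverts ?y s" by simp
  qed
  have "?C d \<and> (\<forall>c. ?C c \<longrightarrow> inverts (g \<otimes> (c \<otimes> d)) s = inverts (g \<otimes> c) s)"
    using assms(5)
  proof induction
    case one
    then show ?case using s assms by simp
  next
    case (incl h)
    then show ?case using gen[of h] by blast
  next
    case (inv h)
    then show ?case using gen[of h] S_inv[of h] by simp
  next
    case (eng h1 h2)
    have "inverts (g \<otimes> (c \<otimes> (h1 \<otimes> h2))) s = inverts (g \<otimes> c) s" if "?C c" for c
    proof -
      have "c \<otimes> (h1 \<otimes> h2) = (c \<otimes> h1) \<otimes> h2" using eng that by (simp add: m_assoc)
      then show ?thesis using eng that C_mult[of c h1] by simp
    qed
    with eng C_mult show ?case by blast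
  qed
  with assms(6,7) show ?thesis by blast
qed

subsection \<open>The nested condition\<close>

text \<open>The alternatives of the nested condition name equalities only for \<open>X\<close>;
  complementation turns an equality for \<open>Y\<close> into one for \<open>X\<close>, so they
  amount to four inclusions.\<close>

lemma comparable_iff:
  fixes A B X Y :: "'a :: order"
  assumes "Y = A \<Longrightarrow> X = B" "Y = B \<Longrightarrow> X = A"
  shows "(X = A \<or> X = B \<or> X < A \<or> X < B \<or> Y < A \<or> Y < B) \<longleftrightarrow> X \<le> A \<or> X \<le> B \<or> Y \<le> A \<or> Y \<le> B"
  using assms by (metis order_le_less)

text \<open>The two roots partition the chambers, also after translation, so each inclusion says
  that one of four intersections is empty; \<open>b\<close> and \<open>c\<close> select it.\<close>

lemma nested_condition_iff:
  assumes "s \<in> S"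
  shows "nested_condition W S s \<longleftrightarrow> (\<forall>g\<in>carrier W. \<exists>b c. \<forall>x\<in>carrier W.
    \<not> (inverts x s = b \<and> inverts (g \<otimes> x) s = c))"
proof -
  define A where "A = {x \<in> carrier W. \<not> inverts x s}"
  define B where "B = {x \<in> carrier W. inverts x s}"
  have chamber: "chamber W x = {x}" if "x \<in> carrier W" for x
    using that by (simp add: chamber_def generate_empty l_coset_def)
  have pos: "pos_root W S s = (\<lambda>x. {x}) ` A"
    using assms unfolding pos_root_def A_def
    by (auto simp: chamber not_inverts_iff_len image_def; metis chamber)
  have neg: "neg_root W S s = (\<lambda>x. {x}) ` B"
    using assms unfolding neg_root_def B_def
    by (auto simp: chamber inverts_iff_len image_def; metis chamber)
  have act: "act W g ((\<lambda>x. {x}) ` X) = (\<lambda>x. {x}) ` ((\<otimes>) g ` X)" for g X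
    by (auto simp: act_def l_coset_def image_image)
  have "inj (\<lambda>x :: 'g. {x})" by simp
  note inj = inj_image_subset_iff[OF this] inj_image_eq_iff[OF this]
  have key: "((\<otimes>) g ` A = A \<or> (\<otimes>) g ` A = B \<or> (\<otimes>) g ` A \<subset> A \<or> (\<otimes>) g ` A \<subset> B \<or>
      (\<otimes>) g ` B \<subset> A \<or> (\<otimes>) g ` B \<subset> B) \<longleftrightarrow> (\<exists>b c. \<forall>x\<in>carrier W. \<not> (inverts x s = b \<and> inverts (g \<otimes> x) s = c))"
    (is "?L \<longleftrightarrow> ?R") if g: "g \<in> carrier W" for g
  proof -
    have part: "(\<otimes>) g ` A = carrier W - (\<otimes>) g ` B"
    proof -
      have "inj_on ((\<otimes>) g) (carrier W)" using g by (simp add: inj_on_def)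
      moreover have "(\<otimes>) g ` carrier W = carrier W"
      proof
        show "carrier W \<subseteq> (\<otimes>) g ` carrier W"
        proof
          fix x assume "x \<in> carrier W"
          then show "x \<in> (\<otimes>) g ` carrier W"
            using g by (intro image_eqI[of _ _ "inv g \<otimes> x"]) (auto simp: m_assoc[symmetric])
        qed
      qed (use g in auto)
      moreover have "A = carrier W - B" by (auto simp: A_def B_def)
      ultimately show ?thesis by (simp add: inj_on_image_set_diff B_def)
    qed
    have "carrier W - B = A" "carrier W - A = B" by (auto simp: A_def B_def)
    with part have "(\<otimes>) g ` B = A \<Longrightarrow> (\<otimes>) g ` A = B" "(\<otimes>) g ` B = B \<Longrightarrow> (\<otimes>) g ` A = A"
      by (simp_all only:)
    then have "?L \<longleftrightarrow> (\<otimes>) g ` A \<subseteq> A \<or> (\<otimes>) g ` A \<subseteq> B \<or> (\<otimes>) g ` B \<subseteq> A \<or> (\<otimes>) g ` B \<subseteq> B"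
      by (rule comparable_iff)
    also have "\<dots> \<longleftrightarrow> ?R"
      using g by (auto simp: A_def B_def image_subset_iff ex_bool_eq)
    finally show ?thesis .
  qed
  show ?thesis
    unfolding nested_condition_def pos neg act psubset_eq inj
    by (intro ball_cong refl key[unfolded psubset_eq])
qed

text \<open>If the label were finite and not 2, then for \<open>g = u\<close> the elements
  \<open>\<one>\<close>, \<open>u \<otimes> s\<close> and \<open>s\<close> would occupy three
  intersections. With the fourth empty, left multiplication by \<open>s \<otimes> u\<close>
  preserves the negative root; iterated from \<open>s\<close> it reaches \<open>u\<close>, which
  lies in the positive root.\<close>

lemma nested_condition_imp_m:
  assumes "nested_condition W S s" "s \<in> S" "u \<in> S" "u \<noteq> s"
  shows "m s u \<in> {2, \<infinity>}"
proof (rule ccontr)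
  assume "m s u \<notin> {2, \<infinity>}"
  then obtain n where n: "m s u = enat n" and "m s u \<noteq> 2" by auto
  have c: "s \<in> carrier W" "u \<in> carrier W" using assms S_carrier by auto
  have nc: "s \<otimes> u \<noteq> u \<otimes> s" using not_commute assms \<open>m s u \<noteq> 2\<close> by simp
  have "concat (replicate n [(s, True), (u, True)]) \<in> relators"
    using n assms unfolding coxeter_relators_def by blast
  then have pow: "(s \<otimes> u) [^] n = \<one>" using ev_relator ev_alternating assms by metis
  have s: "inverts s s" and u: "\<not> inverts u s"
    using assms c by (auto simp: inverts_gen)
  have us: "\<not> inverts (u \<otimes> s) s"
  proof -
    have "u \<otimes> s \<otimes> u \<noteq> s"
    proof
      assume "u \<otimes> s \<otimes> u = s"
      then have "s \<otimes> u = (u \<otimes> s \<otimes> u) \<otimes> u" by simp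
      also have "\<dots> = u \<otimes> s" using assms c by (simp add: m_assoc S_square)
      finally show False using nc by contradiction
    qed
    then show ?thesis using assms c by (auto simp: inverts_mult inverts_gen S_inv)
  qed
  have "\<exists>b d. \<forall>x\<in>carrier W. \<not> (inverts x s = b \<and> inverts (u \<otimes> x) s = d)"
    using assms(1) c(2) unfolding nested_condition_iff[OF assms(2)] by (rule bspec)
  then obtain b d where bd: "\<And>x. x \<in> carrier W \<Longrightarrow> inverts x s = b \<Longrightarrow> inverts (u \<otimes> x) s \<noteq> d"
    by blast
  have "b"
  proof (rule ccontr)
    assume "\<not> b"
    then have "d" "\<not> d"
      using bd[of \<one>] bd[of "u \<otimes> s"] us u c s assms by (auto simp: inverts_one S_cancel)
    then show False by simp
  qed
  moreover have "d" using bd[of s] us s c \<open>b\<close> by auto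
  ultimately have step: "inverts (s \<otimes> (u \<otimes> x)) s" if "inverts x s" "x \<in> carrier W" for x
    using bd[of x] that assms c by (simp add: inverts_gen_mult)
  have "inverts ((s \<otimes> u) [^] k \<otimes> s) s" for k :: nat
  proof (induction k)
    case 0
    then show ?case using s c by simp
  next
    case (Suc k)
    have "(s \<otimes> u) [^] Suc k \<otimes> s = s \<otimes> (u \<otimes> ((s \<otimes> u) [^] k \<otimes> s))"
      using c nat_pow_Suc2[of "s \<otimes> u" k] by (simp add: m_assoc)
    with Suc step[of "(s \<otimes> u) [^] k \<otimes> s"] c show ?case by simp
  qed
  moreover have "(s \<otimes> u) [^] (n - 1) \<otimes> s = u"
  proof -
    have "n \<noteq> 0" using n m_ge_2[of s u] assms by (auto simp: numeral_eq_enat)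
    then have "(s \<otimes> u) [^] (n - 1) \<otimes> (s \<otimes> u) = \<one>"
      using pow nat_pow_Suc[of "s \<otimes> u" "n - 1"] by simp
    then have "(s \<otimes> u) [^] (n - 1) \<otimes> s \<otimes> u = u \<otimes> u"
      using c assms by (simp add: m_assoc S_square)
    then show ?thesis using c by (simp del: S_square)
  qed
  ultimately show False using u by metis
qed

lemma nested_condition_if_m:
  assumes "\<forall>u\<in>S - {s}. m s u \<in> {2, \<infinity>}" "s \<in> S"
  shows "nested_condition W S s"
  unfolding nested_condition_iff[OF assms(2)]
proof (rule ballI, rule ccontr)
  fix g assume g: "g \<in> carrier W"
    and "\<nexists>b c. \<forall>x\<in>carrier W. \<not> (inverts x s = b \<and> inverts (g \<otimes> x) s = c)"
  then have quadrant: "\<exists>x\<in>carrier W. inverts x s = b \<and> inverts (g \<otimes> x) s = c" for b c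
    by blast
  have s: "s \<in> carrier W" using assms S_carrier by blast
  \<comment> \<open>If \<open>g\<close> commuted with \<open>s\<close>, it would preserve the wall
    and leave two intersections empty.\<close>
  have ncomm: "s \<otimes> g \<noteq> g \<otimes> s"
  proof
    assume "s \<otimes> g = g \<otimes> s"
    then have "inv g \<otimes> s \<otimes> g = s"
      using s g inv_solve_left'[of s g "s \<otimes> g"] by (simp add: m_assoc)
    then have "inverts (g \<otimes> x) s = (inverts g s \<noteq> inverts x s)" if "x \<in> carrier W" for x
      using inverts_mult[of g x s] that g s by simp
    then show False
      using quadrant[of True "inverts g s"] by auto
  qed
  have "s \<otimes> inv g \<noteq> inv g \<otimes> s"
  proof
    assume *: "s \<otimes> inv g = inv g \<otimes> s"
    have "g \<otimes> s = g \<otimes> (s \<otimes> inv g) \<otimes> g" using s g by (simp add: m_assoc)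
    also have "\<dots> = s \<otimes> g" unfolding * using s g by (simp add: m_assoc[symmetric])
    finally show False using ncomm by simp
  qed
  obtain a where "a \<in> carrier W" "\<not> inverts a s" "inverts (g \<otimes> a) s \<noteq> inverts g s"
    using quadrant[of False "\<not> inverts g s"] by blast
  then obtain y where y: "y \<in> carrier W" "s \<otimes> y = y \<otimes> s" "\<not> inverts (inv g \<otimes> y) s"
    using halfspace_crosses_wall[OF assms g] by blast
  \<comment> \<open>The negative root translated by \<open>g\<close> is the positive root translated
    by \<open>g \<otimes> s\<close>, so the crossing lemma applies again, with
    \<open>s \<otimes> x\<close>.\<close>
  obtain x where x: "x \<in> carrier W" "inverts x s" "inverts (g \<otimes> x) s \<noteq> inverts (g \<otimes> s) s"
    using quadrant[of True "\<not> inverts (g \<otimes> s) s"] by blast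
  have "(g \<otimes> s) \<otimes> (s \<otimes> x) = g \<otimes> x"
    using g s x assms by (simp add: m_assoc S_cancel)
  then have "\<exists>y\<in>carrier W. s \<otimes> y = y \<otimes> s \<and> \<not> inverts (inv (g \<otimes> s) \<otimes> y) s"
    using g s x assms
    by (intro halfspace_crosses_wall[OF assms, of _ "s \<otimes> x"]) (simp_all add: inverts_gen_mult)
  then obtain z where z: "z \<in> carrier W" "s \<otimes> z = z \<otimes> s" "\<not> inverts (inv (g \<otimes> s) \<otimes> z) s"
    by blast
  have "inv (g \<otimes> s) \<otimes> z = s \<otimes> (inv g \<otimes> z)"
    using g s z assms by (simp add: inv_mult_group S_inv m_assoc)
  then have "inverts (inv g \<otimes> z) s"
    using z g assms by (simp add: inverts_gen_mult)
  \<comment> \<open>\<open>y\<close> and \<open>z\<close> lie on opposite sides of the wall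
    translated by \<open>g\<close>, yet \<open>?d\<close> joins them within the centralizer.\<close>
  let ?d = "inv y \<otimes> z"
  have yd: "y \<otimes> ?d = z" using y z by (simp add: m_assoc[symmetric])
  have "y \<otimes> (s \<otimes> ?d) = (s \<otimes> y) \<otimes> ?d" using y z s by (simp add: m_assoc)
  also have "\<dots> = s \<otimes> z" using y(1) z(1) s by (simp add: m_assoc yd)
  also have "\<dots> = (y \<otimes> ?d) \<otimes> s" using z(2) by (simp only: yd)
  also have "\<dots> = y \<otimes> (?d \<otimes> s)" using y z s by (simp add: m_assoc)
  finally have "s \<otimes> ?d = ?d \<otimes> s" using y z s by simp
  then have "?d \<in> generate W {u \<in> S. u \<otimes> s = s \<otimes> u}"
    using centralizer_generated[OF assms] y z by simp
  then have "inverts (inv g \<otimes> (y \<otimes> ?d)) s = inverts (inv g \<otimes> y) s"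
    using inverts_constant_on_centralizer[OF assms inv_closed[OF g]] y
      \<open>s \<otimes> inv g \<noteq> inv g \<otimes> s\<close> by blast
  with \<open>inverts (inv g \<otimes> z) s\<close> y yd show False by simp
qed

end

theorem proposition2p5:
  fixes W :: "('g, 'b) monoid_scheme" (structure)
    and S :: "'g set" and m :: "'g \<Rightarrow> 'g \<Rightarrow> enat" and s :: 'g
  assumes "coxeter_system W S m" and "s \<in> S"
  shows "nested_condition W S s \<longleftrightarrow> (\<forall>u \<in> S - {s}. m s u \<in> {2, \<infinity>})"
proof -
  interpret coxeter_system W S m by (rule assms(1))
  show ?thesis
    using nested_condition_imp_m nested_condition_if_m assms(2) by blast
qed

end
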